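(* Let $I,J\subseteq\mathbb R$ be open intervals, let $a:I\to\mathbb R$ and $b_1,b_2:J\to\mathbb R$ be arbitrary continuous functions. Put $$\Xi(x):=\exp\left(-\int^x a(\xi)\,\mathrm d\xi\right),\qquad \gamma(t):=\int^t b_1(\tau)\,\mathrm d\tau .$$ The general solution of the extended generalized Buchdahl equations determined by the oscillator Lie--Hamilton algebra $\mathfrak h_4$ ($x\in I$, $y\neq0$, $t\in J$), $$\begin{aligned} \frac{\mathrm dx}{\mathrm dt}&=y-b_2(t)\,\frac{1}{y\,\Xi^2(x)}\int^x\Xi(\xi)\,\mathrm d\xi,\\ \frac{\mathrm dy}{\mathrm dt}&=a(x)y^2+b_1(t)y-b_2(t)\,\frac{1}{\Xi^2(x)}\left(\Xi(x)+a(x)\int^x\Xi(\xi)\,\mathrm d\xi\right), \end{aligned}$$ is given by $$\begin{aligned} \int^x\Xi(\xi)\,\mathrm d\xi&=-\left(c_1+\int^t\mathrm e^{-\gamma(\tau)}b_2(\tau)\,\mathrm d\tau\right)\left(c_2+\int^t\mathrm e^{\gamma(\tau)}\,\mathrm d\tau\right),\\ y(t)&=-\frac{\mathrm e^{\gamma(t)}}{\Xi(x)}\left(c_1+\int^t\mathrm e^{-\gamma(\tau)}b_2(\tau)\,\mathrm d\tau\right), \end{aligned}$$ where $c_1$ and $c_2$ are the two constants of integration determined by the initial conditions. That is, for functions $x:J'\to I$ and $y:J'\to\mathbb R\setminus\{0\}$ on an open interval $J'\subseteq J$, the pair $(x(t),y(t))$ is a solution of the system on $J'$ if and only if there are real constants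 $c_1,c_2$ such that the two displayed formulas hold for all $t\in J'$.
   Context: Indefinite integrals $\int^x(\cdot)\,\mathrm d\xi$ and $\int^t(\cdot)\,\mathrm d\tau$ denote antiderivatives of the integrand, chosen once and for all (the same choice wherever the same integral appears); thus $\Xi>0$, $\Xi'=-a\,\Xi$, $\gamma'=b_1$. The variable $y$ is assumed nonzero throughout. *)

theory Defs
  imports "HOL-Analysis.Analysis"
begin

text \<open>Indefinite integrals are antiderivatives. The sets used below are open, so the two-sided
  derivative is the appropriate one.\<close>

definition antiderivative_on :: "(real \<Rightarrow> real) \<Rightarrow> (real \<Rightarrow> real) \<Rightarrow> real set \<Rightarrow> bool" where
  "antiderivative_on F f S \<longleftrightarrow> (\<forall>s\<in>S. (F has_real_derivative f s) (at s))"

text \<open>In the following system, \<open>\<Xi>\<close> is the integrating factor \<open>exp (- \<integral>\<^sup>x a)\<close>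
  and \<open>P\<close> is the chosen antiderivative of \<open>\<Xi>\<close>.\<close>

definition buchdahl_h4_solution_on ::
  "(real \<Rightarrow> real) \<Rightarrow> (real \<Rightarrow> real) \<Rightarrow> (real \<Rightarrow> real) \<Rightarrow> (real \<Rightarrow> real) \<Rightarrow> (real \<Rightarrow> real)
    \<Rightarrow> real set \<Rightarrow> (real \<Rightarrow> real) \<Rightarrow> (real \<Rightarrow> real) \<Rightarrow> bool" where
  "buchdahl_h4_solution_on a b\<^sub>1 b\<^sub>2 \<Xi> P J' x y \<longleftrightarrow>
    (\<forall>t\<in>J'.
      (x has_real_derivative
         (y t - b\<^sub>2 t * (1 / (y t * (\<Xi> (x t))\<^sup>2)) * P (x t))) (at t) \<and>
      (y has_real_derivative
         (a (x t) * (y t)\<^sup>2 + b\<^sub>1 t * y t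
           - b\<^sub>2 t * (1 / (\<Xi> (x t))\<^sup>2) * (\<Xi> (x t) + a (x t) * P (x t)))) (at t))"

end

theory Submission
  imports Defs
begin

text \<open>The coordinates \<open>u = e\<^bsup>-\<gamma>\<^esup> \<Xi>(x) y\<close> and \<open>q = \<integral>\<^sup>x \<Xi>\<close> linearise the system. Along a
  solution, \<open>u' = - e\<^bsup>-\<gamma>\<^esup> b\<^sub>2\<close> and \<open>(q/u)' = e\<^bsup>\<gamma>\<^esup>\<close>, so both are found by quadrature. Conversely,
  \<open>q\<close> is a differentiable function of \<open>t\<close> by the explicit formula, and since \<open>\<integral>\<^sup>x \<Xi>\<close> is strictly
  increasing with non-vanishing derivative, \<open>x\<close> is differentiable by the inverse function theorem.\<close>

lemma antiderivative_onD:
  "antiderivative_on F f S \<Longrightarrow> s \<in> S \<Longrightarrow> (F has_real_derivative f s) (at s)"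
  by (simp add: antiderivative_on_def)

text \<open>Source of the integration constants: the difference has zero derivative on a convex set,
  so it is constant there.\<close>

lemma antiderivative_on_unique:
  assumes F: "antiderivative_on F f S" and G: "antiderivative_on G f S" and S: "is_interval S"
  shows "\<exists>c. \<forall>s\<in>S. F s = c + G s"
proof -
  have "((\<lambda>s. F s - G s) has_real_derivative 0) (at s within S)" if "s \<in> S" for s
    using DERIV_diff[OF antiderivative_onD[OF F that] antiderivative_onD[OF G that]]
    by (simp add: has_field_derivative_at_within)
  then obtain c where "F s - G s = c" if "s \<in> S" for s
    using has_field_derivative_zero_constant[of S "\<lambda>s. F s - G s"] S is_interval_convex by blast
  then have "\<forall>s\<in>S. F s = c + G s" by (simp add: algebra_simps)
  then show ?thesis ..
qed

lemma antiderivative_on_pos_inj_on: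
  assumes P: "antiderivative_on P p I" and I: "is_interval I" and pos: "\<And>s. s \<in> I \<Longrightarrow> p s > 0"
  shows "inj_on P I"
proof (rule linorder_inj_onI)
  fix s s' assume s: "s < s'" "s \<in> I" "s' \<in> I"
  have "P s < P s'"
  proof (rule DERIV_pos_imp_increasing[OF s(1)])
    fix r assume "s \<le> r" "r \<le> s'"
    then have "r \<in> I" using I s unfolding is_interval_1 by blast
    then show "\<exists>d. (P has_real_derivative d) (at r) \<and> 0 < d"
      using antiderivative_onD[OF P] pos by blast
  qed
  then show "P s \<noteq> P s'" by simp
qed auto

text \<open>Not even continuity of \<open>x\<close> is assumed. As \<open>P\<close> is injective on
  all of \<open>I\<close>, \<open>x\<close> equals \<open>inv_into I P\<close> composed with
  \<open>P (x s)\<close> throughout the open set \<open>T\<close>; the inverse function theorem and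
  the chain rule then give the derivative.\<close>

lemma has_real_derivative_lift_antiderivative:
  assumes P: "antiderivative_on P p I" and I: "is_interval I" "open I"
    and pos: "\<And>s. s \<in> I \<Longrightarrow> p s > 0"
    and T: "open T" "t \<in> T" and x: "\<And>s. s \<in> T \<Longrightarrow> x s \<in> I"
    and q: "((\<lambda>s. P (x s)) has_real_derivative d) (at t)"
  shows "(x has_real_derivative (d / p (x t))) (at t)"
proof -
  let ?g = "inv_into I P"
  have inj: "inj_on P I" by (rule antiderivative_on_pos_inj_on[OF P I(1) pos])
  have xt: "x t \<in> I" using x T by blast
  have cont: "continuous_on I P"
    by (intro continuous_at_imp_continuous_on ballI DERIV_isCont[OF antiderivative_onD[OF P]])
  have "(P has_derivative (*) (p (x t))) (at (x t))"
    using antiderivative_onD[OF P xt] by (simp add: has_field_derivative_def)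
  moreover have "(*) (p (x t)) \<circ> (*) (inverse (p (x t))) = id"
    using pos[OF xt] by (simp add: fun_eq_iff)
  ultimately have "(?g has_derivative (*) (inverse (p (x t)))) (at (P (x t)))"
    by (rule has_derivative_inverse_strong[OF I(2) xt cont, rotated]) (rule inv_into_f_f[OF inj])
  then have "(?g has_real_derivative inverse (p (x t))) (at (P (x t)))"
    by (simp add: has_field_derivative_def)
  from DERIV_chain2[OF this q]
  have "((\<lambda>s. ?g (P (x s))) has_real_derivative d / p (x t)) (at t)"
    by (simp add: field_simps)
  then show ?thesis
    by (rule has_field_derivative_transform_within_open[OF _ T]) (simp add: inj x)
qed

theorem proposition6p1:
  fixes I J J' :: "real set"
    and a b\<^sub>1 b\<^sub>2 :: "real \<Rightarrow> real"
    and A \<Xi> P \<gamma> B G :: "real \<Rightarrow> real"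
    and x y :: "real \<Rightarrow> real"
  assumes "open I" and "is_interval I"
    and "open J" and "is_interval J"
    and "continuous_on I a" and "continuous_on J b\<^sub>1" and "continuous_on J b\<^sub>2"
    and "antiderivative_on A a I"
    and "\<And>\<xi>. \<xi> \<in> I \<Longrightarrow> \<Xi> \<xi> = exp (- A \<xi>)"
    and "antiderivative_on P \<Xi> I"
    and "antiderivative_on \<gamma> b\<^sub>1 J"
    and "antiderivative_on B (\<lambda>\<tau>. exp (- \<gamma> \<tau>) * b\<^sub>2 \<tau>) J"
    and "antiderivative_on G (\<lambda>\<tau>. exp (\<gamma> \<tau>)) J"
    and "open J'" and "is_interval J'" and "J' \<subseteq> J"
    and "\<And>t. t \<in> J' \<Longrightarrow> x t \<in> I"
    and "\<And>t. t \<in> J' \<Longrightarrow> y t \<noteq> 0"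
  shows "buchdahl_h4_solution_on a b\<^sub>1 b\<^sub>2 \<Xi> P J' x y \<longleftrightarrow>
    (\<exists>c\<^sub>1 c\<^sub>2 :: real. \<forall>t\<in>J'.
       P (x t) = - (c\<^sub>1 + B t) * (c\<^sub>2 + G t) \<and>
       y t = - (exp (\<gamma> t) / \<Xi> (x t)) * (c\<^sub>1 + B t))"
proof -
  note A = assms(8) and \<Xi> = assms(9) and P = assms(10) and \<gamma> = assms(11) and B = assms(12)
    and G = assms(13) and xI = assms(17) and y0 = assms(18)
  have \<Xi>pos: "\<Xi> s > 0" if "s \<in> I" for s using \<Xi>[OF that] by simp
  have dA: "(A has_real_derivative a (x t)) (at (x t))"
    and dP: "(P has_real_derivative \<Xi> (x t)) (at (x t))"
    and d\<gamma>: "(\<gamma> has_real_derivative b\<^sub>1 t) (at t)"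
    and dB: "(B has_real_derivative exp (- \<gamma> t) * b\<^sub>2 t) (at t)"
    and dG: "(G has_real_derivative exp (\<gamma> t)) (at t)" if "t \<in> J'" for t
    using antiderivative_onD[OF A xI[OF that]] antiderivative_onD[OF P xI[OF that]]
      antiderivative_onD[OF \<gamma>, of t] antiderivative_onD[OF B, of t] antiderivative_onD[OF G, of t]
      that assms(16) by auto
  show ?thesis
  proof
    assume sol: "buchdahl_h4_solution_on a b\<^sub>1 b\<^sub>2 \<Xi> P J' x y"
    \<comment> \<open>On \<open>I\<close> the factor \<open>exp (- A)\<close> is
      \<open>\<Xi>\<close>; writing it through \<open>A\<close> makes the derivative come straight
      from \<open>A' = a\<close>.\<close>
    define u where "u t = exp (- \<gamma> t - A (x t)) * y t" for t
    have u0: "u t \<noteq> 0" if "t \<in> J'" for t using y0[OF that] by (simp add: u_def)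
    have du: "(u has_real_derivative - (exp (- \<gamma> t) * b\<^sub>2 t)) (at t)"
      and dv: "((\<lambda>t. P (x t) / u t) has_real_derivative exp (\<gamma> t)) (at t)"
      if t: "t \<in> J'" for t
    proof -
      \<comment> \<open>In terms of \<open>p\<close>, \<open>X\<close> and \<open>g\<close> both
        derivative computations become rational identities with nonzero denominators.\<close>
      define p where "p = P (x t)"
      define X where "X = \<Xi> (x t)"
      define g where "g = exp (\<gamma> t)"
      have X: "X > 0" and g: "g > 0" and Y: "y t \<noteq> 0"
        using \<Xi>pos[OF xI[OF t]] y0[OF t] by (auto simp: X_def g_def)
      have e: "exp (- \<gamma> t - A (x t)) = X / g" "exp (- \<gamma> t) = 1 / g"
        using \<Xi>[OF xI[OF t]] by (auto simp: X_def g_def exp_diff exp_minus field_simps)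
      have ut: "u t = X / g * y t" by (simp add: u_def e)
      have dx: "(x has_real_derivative y t - b\<^sub>2 t * (1 / (y t * X\<^sup>2)) * p) (at t)"
          (is "(x has_real_derivative ?x) _")
        and dy: "(y has_real_derivative a (x t) * (y t)\<^sup>2 + b\<^sub>1 t * y t
           - b\<^sub>2 t * (1 / X\<^sup>2) * (X + a (x t) * p)) (at t)"
          (is "(y has_real_derivative ?y) _")
        using sol t by (auto simp: buchdahl_h4_solution_on_def p_def X_def)
      have "(u has_real_derivative
          X / g * (- b\<^sub>1 t - a (x t) * ?x) * y t + X / g * ?y) (at t)"
        unfolding u_def
        by (rule derivative_eq_intros d\<gamma>[OF t] DERIV_chain2[OF dA[OF t] dx] dy refl)+ (simp add: e)
      \<comment> \<open>All terms in \<open>a\<close> and \<open>b\<^sub>1\<close> cancel: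
        \<open>\<Xi>\<close> absorbs the former and \<open>exp (- \<gamma>)\<close> the
        latter.\<close>
      moreover have "X / g * (- b\<^sub>1 t - a (x t) * ?x) * y t + X / g * ?y = - (exp (- \<gamma> t) * b\<^sub>2 t)"
        using X g Y by (simp add: e field_simps power2_eq_square)
      ultimately show du: "(u has_real_derivative - (exp (- \<gamma> t) * b\<^sub>2 t)) (at t)" by simp
      have "((\<lambda>t. P (x t) / u t) has_real_derivative
          ((X * ?x) * u t - p * - (exp (- \<gamma> t) * b\<^sub>2 t)) / (u t * u t)) (at t)"
        using DERIV_divide[OF DERIV_chain2[OF dP[OF t] dx] du u0[OF t]] by (simp add: p_def X_def)
      \<comment> \<open>The two \<open>b\<^sub>2\<close> terms cancel, leaving
        \<open>X * y t / u t\<close>, which is \<open>g\<close>.\<close>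
      moreover have "((X * ?x) * u t - p * - (exp (- \<gamma> t) * b\<^sub>2 t)) / (u t * u t) = g"
        using X g Y by (simp add: e ut field_simps power2_eq_square)
      ultimately show "((\<lambda>t. P (x t) / u t) has_real_derivative exp (\<gamma> t)) (at t)"
        by (simp add: g_def)
    qed
    \<comment> \<open>The sign is chosen so that \<open>- u\<close> and \<open>P (x t) / u t\<close>
      are exactly the two factors \<open>c\<^sub>1 + B t\<close> and \<open>c\<^sub>2 + G t\<close>
      of the claimed formula.\<close>
    have "antiderivative_on (\<lambda>t. - u t) (\<lambda>\<tau>. exp (- \<gamma> \<tau>) * b\<^sub>2 \<tau>) J'"
      unfolding antiderivative_on_def using DERIV_minus[OF du] by simp
    moreover have "antiderivative_on B (\<lambda>\<tau>. exp (- \<gamma> \<tau>) * b\<^sub>2 \<tau>) J'"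
      using dB by (simp add: antiderivative_on_def)
    ultimately have "\<exists>c. \<forall>t\<in>J'. - u t = c + B t"
      by (rule antiderivative_on_unique[OF _ _ assms(15)])
    then obtain c\<^sub>1 where c\<^sub>1: "- u t = c\<^sub>1 + B t" if "t \<in> J'" for t
      by blast
    have "antiderivative_on (\<lambda>t. P (x t) / u t) (\<lambda>\<tau>. exp (\<gamma> \<tau>)) J'"
      "antiderivative_on G (\<lambda>\<tau>. exp (\<gamma> \<tau>)) J'"
      using dv dG by (simp_all add: antiderivative_on_def)
    then have "\<exists>c. \<forall>t\<in>J'. P (x t) / u t = c + G t"
      by (rule antiderivative_on_unique[OF _ _ assms(15)])
    then obtain c\<^sub>2 where c\<^sub>2: "P (x t) / u t = c\<^sub>2 + G t" if "t \<in> J'" for t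
      by blast
    have "P (x t) = - (c\<^sub>1 + B t) * (c\<^sub>2 + G t) \<and> y t = - (exp (\<gamma> t) / \<Xi> (x t)) * (c\<^sub>1 + B t)"
      if t: "t \<in> J'" for t
      unfolding c\<^sub>1[OF t, symmetric] c\<^sub>2[OF t, symmetric]
      using u0[OF t] \<Xi>[OF xI[OF t]] by (simp add: u_def exp_diff exp_minus field_simps)
    then show "\<exists>c\<^sub>1 c\<^sub>2. \<forall>t\<in>J'. P (x t) = - (c\<^sub>1 + B t) * (c\<^sub>2 + G t) \<and>
       y t = - (exp (\<gamma> t) / \<Xi> (x t)) * (c\<^sub>1 + B t)" by blast
  next
    assume "\<exists>c\<^sub>1 c\<^sub>2. \<forall>t\<in>J'. P (x t) = - (c\<^sub>1 + B t) * (c\<^sub>2 + G t) \<and>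
       y t = - (exp (\<gamma> t) / \<Xi> (x t)) * (c\<^sub>1 + B t)"
    then obtain c\<^sub>1 c\<^sub>2 where
      Pt: "\<And>t. t \<in> J' \<Longrightarrow> P (x t) = - (c\<^sub>1 + B t) * (c\<^sub>2 + G t)" and
      yt: "\<And>t. t \<in> J' \<Longrightarrow> y t = - (exp (\<gamma> t) / \<Xi> (x t)) * (c\<^sub>1 + B t)" by blast
    show "buchdahl_h4_solution_on a b\<^sub>1 b\<^sub>2 \<Xi> P J' x y"
      unfolding buchdahl_h4_solution_on_def
    proof (intro ballI conjI)
      fix t assume t: "t \<in> J'"
      define X where "X = \<Xi> (x t)"
      define g where "g = exp (\<gamma> t)"
      define C where "C = c\<^sub>1 + B t"
      define D where "D = c\<^sub>2 + G t"
      have X: "X > 0" and g: "g > 0" using \<Xi>pos[OF xI[OF t]] by (auto simp: X_def g_def)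
      have e: "exp (\<gamma> t + A (x t)) = g / X" "exp (- \<gamma> t) = 1 / g"
        by (simp_all add: X_def g_def \<Xi>[OF xI[OF t]] exp_add exp_minus divide_inverse)
      have p: "P (x t) = - C * D" and Y: "y t = - (g / X) * C"
        using Pt[OF t] yt[OF t] by (auto simp: C_def D_def X_def g_def)
      \<comment> \<open>The system divides by \<open>y\<close>, and \<open>y\<close> is a nonzero
        multiple of \<open>C\<close>; later \<open>C\<close> cancels from
        \<open>P (x t) / y t\<close>.\<close>
      have C: "C \<noteq> 0" using y0[OF t] Y by auto
      have "((\<lambda>t. - (c\<^sub>1 + B t) * (c\<^sub>2 + G t)) has_real_derivative - (1 / g * b\<^sub>2 t) * D - C * g) (at t)"
        by (rule derivative_eq_intros dB[OF t] dG[OF t] refl)+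
          (simp add: C_def D_def g_def exp_minus field_simps)
      then have "((\<lambda>t. P (x t)) has_real_derivative - (1 / g * b\<^sub>2 t) * D - C * g) (at t)"
        by (rule has_field_derivative_transform_within_open[OF _ assms(14) t]) (simp only: Pt)
      \<comment> \<open>The formula gives \<open>x\<close> only implicitly, through
        \<open>P (x t)\<close>; since \<open>P' = \<Xi> > 0\<close> on \<open>I\<close>, its
        derivative transfers to \<open>x\<close> after division by \<open>X\<close>.\<close>
      then have "(x has_real_derivative (- (1 / g * b\<^sub>2 t) * D - C * g) / X) (at t)"
        unfolding X_def
        by (intro has_real_derivative_lift_antiderivative[OF P assms(2,1) _ assms(14) t] \<Xi>pos xI)
      moreover have "(- (1 / g * b\<^sub>2 t) * D - C * g) / X
          = y t - b\<^sub>2 t * (1 / (y t * X\<^sup>2)) * P (x t)" (is "_ = ?x")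
        using X g C by (simp add: p Y field_simps power2_eq_square)
      ultimately have dx: "(x has_real_derivative ?x) (at t)" by simp
      then show "(x has_real_derivative y t - b\<^sub>2 t * (1 / (y t * (\<Xi> (x t))\<^sup>2)) * P (x t)) (at t)"
        by (simp add: X_def)
      \<comment> \<open>This function is \<open>y\<close> on \<open>J'\<close>, with
        \<open>1 / \<Xi>\<close> written as \<open>exp A\<close>. Differentiating it requires the
        equation for \<open>x\<close> just proved; openness of \<open>J'\<close> then carries the
        derivative over to \<open>y\<close>.\<close>
      have "((\<lambda>t. - (exp (\<gamma> t + A (x t)) * (c\<^sub>1 + B t))) has_real_derivative
          - (g / X * (b\<^sub>1 t + a (x t) * ?x) * C + g / X * (1 / g * b\<^sub>2 t))) (at t)"
        by (rule derivative_eq_intros d\<gamma>[OF t] DERIV_chain2[OF dA[OF t] dx] dB[OF t] refl)+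
          (simp add: e C_def)
      then have "(y has_real_derivative
          - (g / X * (b\<^sub>1 t + a (x t) * ?x) * C + g / X * (1 / g * b\<^sub>2 t))) (at t)"
        by (rule has_field_derivative_transform_within_open[OF _ assms(14) t])
          (simp add: yt \<Xi> xI exp_add exp_minus field_simps)
      moreover have "- (g / X * (b\<^sub>1 t + a (x t) * ?x) * C + g / X * (1 / g * b\<^sub>2 t))
          = a (x t) * (y t)\<^sup>2 + b\<^sub>1 t * y t - b\<^sub>2 t * (1 / X\<^sup>2) * (X + a (x t) * P (x t))"
        using X g C by (simp add: p Y field_simps power2_eq_square)
      ultimately show "(y has_real_derivative a (x t) * (y t)\<^sup>2 + b\<^sub>1 t * y t
           - b\<^sub>2 t * (1 / (\<Xi> (x t))\<^sup>2) * (\<Xi> (x t) + a (x t) * P (x t))) (at t)"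
        by (simp add: X_def)
    qed
  qed
qed

end
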